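(* For every $u_0:V\to\mathbb{R}$ there exists some $T_0>0$ such that the Cauchy problem $$\partial_t u=\Delta u-au+|u|^{p-1}u\quad (x\in V,\ t>0),\qquad u(x,0)=u_0(x)\quad (x\in V)$$ has a unique solution $u(x,t)$ on $V\times[0,T_0]$. Moreover, if $u_0\geq 0$ on $V$, then $u(x,t)\geq 0$ for all $(x,t)\in V\times[0,T_0]$.
   Context: $G=(V,E,\mu,\omega)$ is a finite connected graph with vertex set $V=\{x_1,\dots,x_N\}$, positive measure $\mu:V\to(0,\infty)$ and positive symmetric edge weights $\omega_{xy}=\omega_{yx}>0$; $y\sim x$ means that $x,y$ are joined by an edge. The $\mu$-Laplacian is $\Delta u(x)=\frac{1}{\mu(x)}\sum_{y\sim x}\omega_{xy}(u(y)-u(x))$. Fixed data: $p>1$ and $a:V\to\mathbb{R}$ with $a(x)\ge 0$ for all $x\in V$ and $a\not\equiv 0$. A solution on $V\times[0,T_0]$ is a function $u$ with $u(x,\cdot)\in C^1[0,T_0]$ for each $x\in V$ satisfying the equation and the initial condition. *)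

theory Defs
  imports "HOL-Analysis.Analysis" "Graph_Theory.Graph_Theory"
begin

text \<open>
  A finite undirected graph is a \<^locale>\<open>pair_pseudo_graph\<close>: finitely many vertices, and an edge
  \<open>x \<sim> y\<close> is represented by the two arcs \<open>(x, y)\<close>, \<open>(y, x)\<close>. Loops are permitted but
  contribute nothing to the Laplacian. Functions on the vertex set are total functions on the
  vertex type, and only their values on \<open>pverts G\<close> matter.
\<close>

definition graph_laplacian ::
  "'a pair_pre_digraph \<Rightarrow> ('a \<Rightarrow> real) \<Rightarrow> ('a \<Rightarrow> 'a \<Rightarrow> real) \<Rightarrow> ('a \<Rightarrow> real) \<Rightarrow> 'a \<Rightarrow> real" where
  "graph_laplacian G \<mu> \<omega> f x =
     1 / \<mu> x * (\<Sum>y | (x, y) \<in> parcs G. \<omega> x y * (f y - f x))"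

text \<open>
  The library's \<^const>\<open>C1_differentiable_on\<close> asks for two-sided derivatives also at the end
  points of an interval, hence depends on values outside it. Here the derivative is taken
  within the set, so it is one-sided at the end points.
\<close>

definition C1_within :: "real set \<Rightarrow> (real \<Rightarrow> real) \<Rightarrow> bool" where
  "C1_within S f \<longleftrightarrow>
     (\<exists>f'. continuous_on S f' \<and> (\<forall>t\<in>S. (f has_real_derivative f' t) (at t within S)))"

definition cauchy_solution ::
  "'a pair_pre_digraph \<Rightarrow> ('a \<Rightarrow> real) \<Rightarrow> ('a \<Rightarrow> 'a \<Rightarrow> real) \<Rightarrow> real \<Rightarrow> ('a \<Rightarrow> real) \<Rightarrow>
   ('a \<Rightarrow> real) \<Rightarrow> real \<Rightarrow> ('a \<Rightarrow> real \<Rightarrow> real) \<Rightarrow> bool" where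
  "cauchy_solution G \<mu> \<omega> p a u\<^sub>0 T u \<longleftrightarrow>
     (\<forall>x\<in>pverts G.
        C1_within {0..T} (u x) \<and>
        (\<forall>t\<in>{0<..T}. (u x has_real_derivative
            graph_laplacian G \<mu> \<omega> (\<lambda>y. u y t) x - a x * u x t + \<bar>u x t\<bar> powr (p - 1) * u x t)
            (at t within {0..T})) \<and>
        u x 0 = u\<^sub>0 x)"

end

theory Submission
  imports Defs "HOL-Probability.Discrete_Topology"
begin

text \<open>
  Since the graph is finite, the Cauchy problem is an ordinary differential equation
  \<open>u' = F(u)\<close> in a finite-dimensional space. The map \<open>s \<mapsto> \<bar>s\<bar>\<^sup>p\<^sup>-\<^sup>1 s\<close> is continuously
  differentiable because \<open>p > 1\<close>, so \<open>F\<close> is Lipschitz on bounded sets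
  (\<open>signed_powr_lipschitz\<close>, \<open>heat_rhs_lipschitz\<close>) and the Picard-Lindeloef theorem
  (\<open>picard_lindelof\<close>) gives a solution on some interval \<open>[0, T]\<close>.

  Uniqueness and nonnegativity have a common source, the comparison principle
  \<open>cauchy_solution_mono\<close>: of two solutions on the same interval, the one that starts
  below stays below. Applied in both directions to two solutions with the same initial value it
  gives uniqueness; applied to the zero solution it gives nonnegativity. It holds because
  the system is cooperative. For the difference \<open>d = u - v\<close>, the value at a vertex is pushed
  upwards only by positive values of \<open>d\<close> at the neighbours and, through the Lipschitz
  nonlinearity, by its own positive value. Hence the energy \<open>\<Sum>x. (max 0 (d x))\<^sup>2\<close>, which vanishes
  initially, satisfies \<open>E' \<le> K E\<close>, and Gronwall's argument makes it vanish for all times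
  (\<open>cooperative_system_nonpos\<close>).
\<close>

text \<open>
  States will be functions on the vertices with the supremum norm, that is, bounded continuous
  functions on the vertex type with its discrete topology. Only the vertex set
  is finite, not the vertex type, so the latter cannot index a Euclidean space; the supremum norm
  works for both.
\<close>

instance bcontfun :: (metric_space, banach) banach ..

section \<open>Local solvability in a Banach space\<close>

text \<open>
  The fixed point iteration takes place in the closed set \<open>S\<close> of bounded continuous paths with
  values in the ball. These paths are defined on the whole real line; precomposition with
  \<^const>\<open>clamp\<close> extends a path constantly beyond \<open>[0, T]\<close>, so that no information outside the
  interval enters the supremum norm.
\<close>

lemma picard_lindelof:
  fixes F :: "'b::banach \<Rightarrow> 'b"
  assumes lip: "L-lipschitz_on (cball x\<^sub>0 r) F" and r: "r > 0"
  obtains T u where "T > 0" "u 0 = x\<^sub>0"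
    "\<And>t. t \<in> {0..T} \<Longrightarrow> u t \<in> cball x\<^sub>0 r"
    "\<And>t. t \<in> {0..T} \<Longrightarrow> (u has_vector_derivative F (u t)) (at t within {0..T})"
proof -
  have L: "L \<ge> 0" using lip by (rule lipschitz_on_nonneg)
  define B where "B = norm (F x\<^sub>0) + L * r"
  have B: "B \<ge> 0" unfolding B_def using L r by simp
  have bound: "norm (F y) \<le> B" if "y \<in> cball x\<^sub>0 r" for y
  proof -
    have "dist (F x\<^sub>0) (F y) \<le> L * dist x\<^sub>0 y"
      using lipschitz_onD[OF lip _ that, of x\<^sub>0] r by simp
    also have "\<dots> \<le> L * r" using that L by (simp add: mult_left_mono)
    finally show ?thesis
      unfolding B_def dist_norm using norm_triangle_sub[of "F y" "F x\<^sub>0"]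
      by (simp add: norm_minus_commute)
  qed
  \<comment> \<open>The first bound keeps the iterates in the ball, the second makes the iteration contract.\<close>
  define T where "T = r / (B + 1)"
  have T: "T > 0" and TB: "T * B \<le> r" and TL: "T * L < 1"
  proof -
    show "T > 0" unfolding T_def using r B by simp
    show "T * B \<le> r" unfolding T_def using r B by (simp add: field_simps)
    have "L * r \<le> B" unfolding B_def by simp
    then show "T * L < 1" unfolding T_def using B by (simp add: field_simps)
  qed
  define S :: "(real \<Rightarrow>\<^sub>C 'b) set" where "S = PiC UNIV (\<lambda>_. cball x\<^sub>0 r)"
  have S_iff: "\<phi> \<in> S \<longleftrightarrow> (\<forall>t. \<phi> t \<in> cball x\<^sub>0 r)" for \<phi>
    unfolding S_def mem_PiC_iff by auto
  have contF: "continuous_on X (\<lambda>s. F (apply_bcontfun \<phi> s))" if "\<phi> \<in> S" for \<phi> X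
    using that unfolding S_iff
    by (intro continuous_on_compose2[OF lipschitz_on_continuous_on[OF lip]]) auto
  have int: "(\<lambda>s. F (apply_bcontfun \<phi> s)) integrable_on {a..b}" if "\<phi> \<in> S" for \<phi> a b
    by (rule integrable_continuous_interval[OF contF[OF that]])
  have "\<exists>\<psi>. \<forall>t. apply_bcontfun \<psi> t
      = x\<^sub>0 + integral {0..clamp 0 T t} (\<lambda>s. F (apply_bcontfun \<phi> s))" if "\<phi> \<in> S" for \<phi>
  proof -
    have "continuous_on (cbox 0 T) (\<lambda>t. x\<^sub>0 + integral {0..t} (\<lambda>s. F (apply_bcontfun \<phi> s)))"
      using int[OF that, of 0 T]
      by (auto intro!: continuous_intros indefinite_integral_continuous_1)
    from continuous_on_cbox_bcontfunE[OF this] show ?thesis by metis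
  qed
  then obtain P where P: "\<And>\<phi> t. \<phi> \<in> S \<Longrightarrow> apply_bcontfun (P \<phi>) t
      = x\<^sub>0 + integral {0..clamp 0 T t} (\<lambda>s. F (apply_bcontfun \<phi> s))" by metis
  have clamp: "0 \<le> clamp 0 T t" "clamp 0 T t \<le> T" for t :: real
    using clamp_in_interval[of 0 T t] T by auto
  have "\<exists>!\<phi>. \<phi> \<in> S \<and> P \<phi> = \<phi>"
  proof (rule Banach_fix)
    show "complete S"
      unfolding S_def complete_eq_closed by (rule closed_PiC) simp
    show "S \<noteq> {}"
      using r S_iff[of "const_bcontfun x\<^sub>0"] by auto
    show "0 \<le> T * L" "T * L < 1" using T L TL by auto
    show "P ` S \<subseteq> S"
    proof safe
      fix \<phi> assume \<phi>: "\<phi> \<in> S"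
      have "norm (integral {0..clamp 0 T t} (\<lambda>s. F (apply_bcontfun \<phi> s))) \<le> r" for t
      proof -
        have "norm (integral {0..clamp 0 T t} (\<lambda>s. F (apply_bcontfun \<phi> s)))
            \<le> B * (clamp 0 T t - 0)"
          using \<phi> clamp[of t] by (intro integral_bound contF bound) (auto simp: S_iff)
        also have "\<dots> \<le> B * T" using clamp[of t] B by (simp add: mult_left_mono)
        finally show ?thesis using TB by (simp add: mult.commute)
      qed
      then show "P \<phi> \<in> S" unfolding S_iff by (simp add: P[OF \<phi>] dist_norm)
    qed
    show "dist (P \<phi>) (P \<psi>) \<le> (T * L) * dist \<phi> \<psi>" if "\<phi> \<in> S" "\<psi> \<in> S" for \<phi> \<psi>
    proof (rule dist_bound)
      fix t
      have "dist (P \<phi> t) (P \<psi> t) =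
          norm (integral {0..clamp 0 T t} (\<lambda>s. F (apply_bcontfun \<phi> s) - F (apply_bcontfun \<psi> s)))"
        by (simp add: P that dist_norm integral_diff int)
      also have "\<dots> \<le> (L * dist \<phi> \<psi>) * (clamp 0 T t - 0)"
      proof (rule integral_bound)
        fix s
        have "dist (F (\<phi> s)) (F (\<psi> s)) \<le> L * dist (\<phi> s) (\<psi> s)"
          using that by (intro lipschitz_onD[OF lip]) (auto simp: S_iff)
        also have "\<dots> \<le> L * dist \<phi> \<psi>" using L by (intro mult_left_mono dist_bounded)
        finally show "norm (F (\<phi> s) - F (\<psi> s)) \<le> L * dist \<phi> \<psi>" by (simp add: dist_norm)
      qed (use clamp that in \<open>auto intro!: continuous_intros contF\<close>)
      also have "\<dots> \<le> (L * dist \<phi> \<psi>) * T" using clamp[of t] L by (intro mult_left_mono) auto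
      finally show "dist (P \<phi> t) (P \<psi> t) \<le> (T * L) * dist \<phi> \<psi>" by (simp add: mult_ac)
    qed
  qed
  then obtain \<phi> where \<phi>: "\<phi> \<in> S" "P \<phi> = \<phi>" by blast
  have fixpoint: "\<phi> t = x\<^sub>0 + integral {0..t} (\<lambda>s. F (\<phi> s))" if "t \<in> {0..T}" for t
    using P[OF \<phi>(1), of t] that by (simp add: \<phi>(2) clamp_cancel_cbox)
  show thesis
  proof
    show "T > 0" by fact
    show "\<phi> 0 = x\<^sub>0" using fixpoint[of 0] T by simp
    show "\<phi> t \<in> cball x\<^sub>0 r" for t using \<phi> by (simp add: S_iff)
    show "(\<phi> has_vector_derivative F (\<phi> t)) (at t within {0..T})" if "t \<in> {0..T}" for t
    proof (rule has_vector_derivative_transform[OF that])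
      show "((\<lambda>t. x\<^sub>0 + integral {0..t} (\<lambda>s. F (\<phi> s))) has_vector_derivative F (\<phi> t))
          (at t within {0..T})"
        using integral_has_vector_derivative[OF contF[OF \<phi>(1)] that]
        by (auto intro!: derivative_eq_intros)
    qed (use fixpoint in auto)
  qed
qed

section \<open>Comparison\<close>

text \<open>
  A growth bound on the positive components suffices because the derivative of
  \<open>(max 0 s)\<^sup>2\<close> is \<open>2 max 0 s\<close>, which vanishes for \<open>s \<le> 0\<close>: only positive components contribute to
  the derivative of the energy \<open>E\<close>. Squaring the positive part is what makes it differentiable.
  The Cauchy-Schwarz inequality then bounds \<open>E'\<close> by a multiple of \<open>E\<close>.
\<close>

lemma cooperative_system_nonpos:
  fixes d d' :: "'a \<Rightarrow> real \<Rightarrow> real"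
  assumes fin: "finite V" and C: "C \<ge> 0"
    and cont: "\<And>x. x \<in> V \<Longrightarrow> continuous_on {0..T} (d x)"
    and deriv: "\<And>x t. x \<in> V \<Longrightarrow> 0 < t \<Longrightarrow> t < T \<Longrightarrow> (d x has_real_derivative d' x t) (at t)"
    and init: "\<And>x. x \<in> V \<Longrightarrow> d x 0 \<le> 0"
    and le: "\<And>x t. x \<in> V \<Longrightarrow> 0 < t \<Longrightarrow> t < T \<Longrightarrow> d x t > 0 \<Longrightarrow>
               d' x t \<le> C * (\<Sum>y\<in>V. max 0 (d y t))"
    and x: "x \<in> V" and t: "t \<in> {0..T}"
  shows "d x t \<le> 0"
proof -
  have sq_deriv: "((\<lambda>s. (max 0 s)\<^sup>2) has_real_derivative 2 * max 0 s) (at s)" for s :: real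
  proof -
    consider "s > 0" | "s < 0" | "s = 0" by linarith
    then show ?thesis
    proof cases
      case 1
      then have "eventually (\<lambda>s. (max 0 s)\<^sup>2 = s\<^sup>2) (nhds s)"
        using eventually_nhds_in_open[of "{0<..}" s] by (auto elim!: eventually_mono)
      moreover have "((\<lambda>s. s\<^sup>2) has_real_derivative 2 * max 0 s) (at s)"
        using 1 by (auto intro!: derivative_eq_intros)
      ultimately show ?thesis by (subst DERIV_cong_ev[OF refl _ refl])
    next
      case 2
      then have "eventually (\<lambda>s. (max 0 s)\<^sup>2 = 0) (nhds s)"
        using eventually_nhds_in_open[of "{..<0}" s] by (auto elim!: eventually_mono)
      moreover have "((\<lambda>s. 0) has_real_derivative 2 * max 0 s) (at s)"
        using 2 by (auto intro!: derivative_eq_intros)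
      ultimately show ?thesis by (subst DERIV_cong_ev[OF refl _ refl])
    next
      case 3
      have "((\<lambda>h::real. max 0 h) \<longlongrightarrow> max 0 0) (at 0)"
        by (intro tendsto_intros)
      moreover have "(max 0 h)\<^sup>2 / h = max 0 h" if "h \<noteq> 0" for h :: real
        using that by (auto simp: max_def power2_eq_square)
      ultimately have "((\<lambda>h::real. (max 0 h)\<^sup>2 / h) \<longlongrightarrow> 0) (at 0)"
        by (subst LIM_equal[where g = "\<lambda>h. max 0 h"]) auto
      then show ?thesis by (simp add: 3 has_field_derivative_iff)
    qed
  qed
  define E where "E = (\<lambda>t. \<Sum>x\<in>V. (max 0 (d x t))\<^sup>2)"
  define K where "K = 2 * C * card V"
  have E_deriv: "(E has_real_derivative (\<Sum>x\<in>V. 2 * max 0 (d x t) * d' x t)) (at t)"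
    if "0 < t" "t < T" for t
    unfolding E_def using that
    by (intro DERIV_sum DERIV_chain2[OF sq_deriv] deriv)
  have E_le: "(\<Sum>x\<in>V. 2 * max 0 (d x t) * d' x t) \<le> K * E t" if "0 < t" "t < T" for t
  proof -
    have "(\<Sum>x\<in>V. 2 * max 0 (d x t) * d' x t)
        \<le> (\<Sum>x\<in>V. 2 * max 0 (d x t) * (C * (\<Sum>y\<in>V. max 0 (d y t))))"
    proof (rule sum_mono)
      fix x assume "x \<in> V"
      then show "2 * max 0 (d x t) * d' x t
          \<le> 2 * max 0 (d x t) * (C * (\<Sum>y\<in>V. max 0 (d y t)))"
        using le[of x t] that by (cases "d x t > 0") (auto intro: mult_left_mono)
    qed
    also have "\<dots> = 2 * C * (\<Sum>x\<in>V. max 0 (d x t))\<^sup>2"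
      by (simp add: power2_eq_square sum_distrib_left sum_distrib_right mult_ac)
    also have "\<dots> \<le> 2 * C * (E t * card V)"
      using sum_squared_le_sum_of_squares[of "\<lambda>x. max 0 (d x t)" V] C
      unfolding E_def by (intro mult_left_mono) (auto simp: mult.commute)
    finally show ?thesis by (simp add: K_def mult_ac)
  qed
  (* Gronwall: the integrating factor turns E' <= K E into monotonicity. *)
  have "exp (- K * 0) * E 0 \<ge> exp (- K * t) * E t"
  proof (rule DERIV_nonpos_imp_decreasing_open[where f = "\<lambda>t. exp (- K * t) * E t"])
    show "0 \<le> t" using t by simp
    show "continuous_on {0..t} (\<lambda>t. exp (- K * t) * E t)"
      unfolding E_def using t
      by (intro continuous_intros continuous_on_subset[OF cont]) auto
    fix s assume s: "0 < s" "s < t"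
    then have s': "s < T" using t by simp
    have "((\<lambda>t. exp (- K * t) * E t) has_real_derivative
        exp (- K * s) * ((\<Sum>x\<in>V. 2 * max 0 (d x s) * d' x s) - K * E s)) (at s)"
      by (rule derivative_eq_intros E_deriv s s' refl | simp add: algebra_simps)+
    moreover have "exp (- K * s) * ((\<Sum>x\<in>V. 2 * max 0 (d x s) * d' x s) - K * E s) \<le> 0"
      using E_le[OF s(1) s'] by (intro mult_nonneg_nonpos) auto
    ultimately show "\<exists>y. ((\<lambda>t. exp (- K * t) * E t) has_real_derivative y) (at s) \<and> y \<le> 0"
      by blast
  qed
  moreover have "E 0 = 0" unfolding E_def using init by (simp add: max_absorb1)
  ultimately have "E t \<le> 0" by (simp add: mult_le_0_iff not_le[symmetric])
  moreover have "(max 0 (d x t))\<^sup>2 \<le> E t"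
    unfolding E_def using x fin by (intro member_le_sum) auto
  ultimately have "(max 0 (d x t))\<^sup>2 \<le> 0" by linarith
  then have "max 0 (d x t) = 0" by (simp only: power2_less_eq_zero_iff)
  then show ?thesis by linarith
qed

section \<open>The power nonlinearity\<close>

text \<open>
  At the origin the difference quotient is \<open>\<bar>h\<bar> powr q\<close>, which tends to zero exactly because
  \<open>q > 0\<close>; elsewhere the function is a smooth power on each side.
\<close>

lemma signed_powr_has_derivative:
  fixes q s :: real
  assumes q: "q > 0"
  shows "((\<lambda>s. \<bar>s\<bar> powr q * s) has_real_derivative (q + 1) * \<bar>s\<bar> powr q) (at s)"
proof -
  consider "s > 0" | "s < 0" | "s = 0" by linarith
  then show ?thesis
  proof cases
    case 1
    then have "eventually (\<lambda>s. \<bar>s\<bar> powr q * s = s powr q * s) (nhds s)"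
      using eventually_nhds_in_open[of "{0<..}" s] by (auto elim!: eventually_mono)
    moreover have "((\<lambda>s. s powr q * s) has_real_derivative (q + 1) * \<bar>s\<bar> powr q) (at s)"
      using 1 by (auto intro!: derivative_eq_intros simp: algebra_simps powr_diff)
    ultimately show ?thesis by (subst DERIV_cong_ev[OF refl _ refl])
  next
    case 2
    then have "eventually (\<lambda>s. \<bar>s\<bar> powr q * s = (- s) powr q * s) (nhds s)"
      using eventually_nhds_in_open[of "{..<0}" s] by (auto elim!: eventually_mono)
    moreover have "((\<lambda>s. (- s) powr q * s) has_real_derivative (q + 1) * \<bar>s\<bar> powr q) (at s)"
      using 2 by (auto intro!: derivative_eq_intros simp: algebra_simps powr_diff field_simps)
    ultimately show ?thesis by (subst DERIV_cong_ev[OF refl _ refl])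
  next
    case 3
    have "((\<lambda>h::real. \<bar>h\<bar> powr q) \<longlongrightarrow> \<bar>0\<bar> powr q) (at 0)"
      using q by (intro tendsto_intros) auto
    then have "((\<lambda>h::real. \<bar>h\<bar> powr q * h / h) \<longlongrightarrow> 0) (at 0)"
      by (subst LIM_equal[where g = "\<lambda>h. \<bar>h\<bar> powr q"]) (use q in auto)
    then show ?thesis by (simp add: 3 has_field_derivative_iff)
  qed
qed

lemma signed_powr_lipschitz:
  fixes q R :: real
  assumes q: "q > 0"
  shows "((q + 1) * R powr q)-lipschitz_on {-R..R} (\<lambda>s. \<bar>s\<bar> powr q * s)"
proof (rule lipschitz_onI)
  fix r s assume "r \<in> {-R..R}" "s \<in> {-R..R}"
  moreover have "(q + 1) * \<bar>z\<bar> powr q \<le> (q + 1) * R powr q" if "z \<in> {-R..R}" for z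
    using that q by (intro mult_left_mono powr_mono2) auto
  ultimately show "dist (\<bar>r\<bar> powr q * r) (\<bar>s\<bar> powr q * s) \<le> (q + 1) * R powr q * dist r s"
    unfolding dist_norm
    using q by (intro field_differentiable_bound[where S = "{-R..R}"
          and f' = "\<lambda>z. (q + 1) * \<bar>z\<bar> powr q"])
      (auto intro: has_field_derivative_at_within signed_powr_has_derivative)
qed (use q in auto)

section \<open>The semilinear heat equation on the graph\<close>

locale semilinear_heat = pair_pseudo_graph G
  for G :: "'a pair_pre_digraph" +
  fixes \<mu> :: "'a \<Rightarrow> real" and \<omega> :: "'a \<Rightarrow> 'a \<Rightarrow> real" and p :: real and a :: "'a \<Rightarrow> real"
  assumes measure_pos: "x \<in> pverts G \<Longrightarrow> \<mu> x > 0"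
    and weight_pos: "(x, y) \<in> parcs G \<Longrightarrow> \<omega> x y > 0"
    and p_gt_1: "p > 1"
    and a_nonneg: "x \<in> pverts G \<Longrightarrow> a x \<ge> 0"
begin

definition weighted_degree :: "'a \<Rightarrow> real" where
  "weighted_degree x = 1 / \<mu> x * (\<Sum>y | (x, y) \<in> parcs G. \<omega> x y)"

definition heat_rhs :: "('a \<Rightarrow> real) \<Rightarrow> 'a \<Rightarrow> real" where
  "heat_rhs f x = graph_laplacian G \<mu> \<omega> f x - a x * f x + \<bar>f x\<bar> powr (p - 1) * f x"

lemma weighted_degree_nonneg: "x \<in> pverts G \<Longrightarrow> weighted_degree x \<ge> 0"
  unfolding weighted_degree_def
  using measure_pos[of x] weight_pos
  by (intro mult_nonneg_nonneg sum_nonneg) (auto intro: less_imp_le)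

lemma graph_laplacian_diff:
  "graph_laplacian G \<mu> \<omega> f x - graph_laplacian G \<mu> \<omega> g x = graph_laplacian G \<mu> \<omega> (\<lambda>y. f y - g y) x"
  unfolding graph_laplacian_def right_diff_distrib[symmetric] sum_subtractf[symmetric]
  by (simp add: algebra_simps)

text \<open>
  This one-sided bound is the maximum principle in quantitative form: only the excess of
  the neighbours over the vertex itself can make the Laplacian large. Applied to \<open>h\<close> and \<open>- h\<close> it
  yields boundedness of the Laplacian. Applied to a difference of two states at a vertex where that
  difference is positive, it yields cooperativity.
\<close>

lemma graph_laplacian_le:
  assumes x: "x \<in> pverts G" and le: "\<And>y. y \<in> pverts G \<Longrightarrow> h y - h x \<le> D"
  shows "graph_laplacian G \<mu> \<omega> h x \<le> weighted_degree x * D"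
proof -
  have "(\<Sum>y | (x, y) \<in> parcs G. \<omega> x y * (h y - h x)) \<le> (\<Sum>y | (x, y) \<in> parcs G. \<omega> x y * D)"
  proof (intro sum_mono mult_left_mono)
    fix y assume "y \<in> {y. (x, y) \<in> parcs G}"
    then show "h y - h x \<le> D" and "0 \<le> \<omega> x y"
      using arc_snd_in_verts[of "(x, y)"] le[of y] weight_pos[of x y] by auto
  qed
  then show ?thesis
    unfolding graph_laplacian_def weighted_degree_def mult.assoc sum_distrib_right
    using measure_pos[OF x] by (intro mult_left_mono) auto
qed

lemma graph_laplacian_abs_le:
  assumes x: "x \<in> pverts G" and le: "\<And>y. y \<in> pverts G \<Longrightarrow> \<bar>h y\<bar> \<le> D"
  shows "\<bar>graph_laplacian G \<mu> \<omega> h x\<bar> \<le> weighted_degree x * (2 * D)"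
proof -
  have "h y - h x \<le> 2 * D" "- h y - - h x \<le> 2 * D" if "y \<in> pverts G" for y
    using le[OF that] le[OF x] by linarith+
  then have "graph_laplacian G \<mu> \<omega> h x \<le> weighted_degree x * (2 * D)"
    and "graph_laplacian G \<mu> \<omega> (\<lambda>y. - h y) x \<le> weighted_degree x * (2 * D)"
    by (intro graph_laplacian_le x; blast)+
  moreover have "graph_laplacian G \<mu> \<omega> (\<lambda>y. - h y) x = - graph_laplacian G \<mu> \<omega> h x"
    using graph_laplacian_diff[of "\<lambda>_. 0" x h] by (simp add: graph_laplacian_def)
  ultimately show ?thesis by linarith
qed

lemma heat_rhs_lipschitz:
  obtains M where "M \<ge> 0"
    "\<And>f g D x. \<lbrakk>\<And>y. y \<in> pverts G \<Longrightarrow> f y \<in> {-R..R} \<and> g y \<in> {-R..R} \<and> \<bar>f y - g y\<bar> \<le> D;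
       x \<in> pverts G\<rbrakk> \<Longrightarrow> \<bar>heat_rhs f x - heat_rhs g x\<bar> \<le> M * D"
proof
  define L where "L = p * R powr (p - 1)"
  have lip: "L-lipschitz_on {-R..R} (\<lambda>s. \<bar>s\<bar> powr (p - 1) * s)"
    using signed_powr_lipschitz[of "p - 1" R] p_gt_1 by (simp add: L_def)
  have L: "L \<ge> 0" using lip by (rule lipschitz_on_nonneg)
  define m where "m x = weighted_degree x * 2 + a x + L" for x
  have m: "m x \<ge> 0" if "x \<in> pverts G" for x
    unfolding m_def using weighted_degree_nonneg[OF that] a_nonneg[OF that] L by simp
  show "sum m (pverts G) \<ge> 0" using m by (simp add: sum_nonneg)
  fix f g :: "'a \<Rightarrow> real" and D x
  assume fg: "\<And>y. y \<in> pverts G \<Longrightarrow> f y \<in> {-R..R} \<and> g y \<in> {-R..R} \<and> \<bar>f y - g y\<bar> \<le> D"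
    and x: "x \<in> pverts G"
  have D: "\<bar>f x - g x\<bar> \<le> D" "D \<ge> 0" using fg[OF x] by auto
  have "\<bar>graph_laplacian G \<mu> \<omega> f x - graph_laplacian G \<mu> \<omega> g x\<bar> \<le> weighted_degree x * (2 * D)"
    unfolding graph_laplacian_diff using fg by (intro graph_laplacian_abs_le x) auto
  moreover have "\<bar>a x * f x - a x * g x\<bar> \<le> a x * D"
    unfolding right_diff_distrib[symmetric] abs_mult
    using a_nonneg[OF x] D by (simp add: mult_left_mono)
  moreover have "\<bar>\<bar>f x\<bar> powr (p - 1) * f x - \<bar>g x\<bar> powr (p - 1) * g x\<bar> \<le> L * D"
  proof -
    have "\<bar>\<bar>f x\<bar> powr (p - 1) * f x - \<bar>g x\<bar> powr (p - 1) * g x\<bar> \<le> L * \<bar>f x - g x\<bar>"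
      using lipschitz_onD[OF lip, of "f x" "g x"] fg[OF x] by (simp add: dist_real_def)
    also have "\<dots> \<le> L * D" using D L by (intro mult_left_mono)
    finally show ?thesis .
  qed
  ultimately have "\<bar>heat_rhs f x - heat_rhs g x\<bar> \<le> m x * D"
    unfolding heat_rhs_def m_def distrib_right by linarith
  also have "\<dots> \<le> sum m (pverts G) * D"
    using m D(2) pair_finite_verts x by (intro mult_right_mono member_le_sum) auto
  finally show "\<bar>heat_rhs f x - heat_rhs g x\<bar> \<le> sum m (pverts G) * D" .
qed

text \<open>
  Cooperativity of the equation. Where \<open>f\<close> exceeds \<open>g\<close>, the potential pulls the difference down
  because \<open>a \<ge> 0\<close>, and the sum of the positive parts dominates both the difference at \<open>x\<close>,
  which bounds the growth of the power term, and its excess at the neighbours, which bounds the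
  Laplacian.
\<close>

lemma heat_rhs_diff_le:
  assumes bounds: "f x \<in> {-R..R}" "g x \<in> {-R..R}"
    and x: "x \<in> pverts G" and less: "g x < f x"
  shows "heat_rhs f x - heat_rhs g x \<le>
    (weighted_degree x + p * R powr (p - 1)) * (\<Sum>y\<in>pverts G. max 0 (f y - g y))"
    (is "_ \<le> (_ + ?L) * ?S")
proof -
  have le_S: "f y - g y \<le> ?S" if "y \<in> pverts G" for y
  proof -
    have "f y - g y \<le> max 0 (f y - g y)" by simp
    also have "\<dots> \<le> ?S" using that pair_finite_verts by (intro member_le_sum) auto
    finally show ?thesis .
  qed
  have lip: "?L-lipschitz_on {-R..R} (\<lambda>s. \<bar>s\<bar> powr (p - 1) * s)"
    using signed_powr_lipschitz[of "p - 1" R] p_gt_1 by simp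
  have "graph_laplacian G \<mu> \<omega> f x - graph_laplacian G \<mu> \<omega> g x \<le> weighted_degree x * ?S"
    unfolding graph_laplacian_diff
  proof (rule graph_laplacian_le[OF x])
    fix y assume "y \<in> pverts G"
    with le_S[of y] less show "f y - g y - (f x - g x) \<le> ?S" by linarith
  qed
  moreover have "a x * g x \<le> a x * f x"
    using less a_nonneg[OF x] by (simp add: mult_left_mono)
  moreover have "\<bar>f x\<bar> powr (p - 1) * f x - \<bar>g x\<bar> powr (p - 1) * g x \<le> ?L * ?S"
  proof -
    have "\<bar>f x\<bar> powr (p - 1) * f x - \<bar>g x\<bar> powr (p - 1) * g x \<le> ?L * (f x - g x)"
      using lipschitz_onD[OF lip bounds] less by (simp add: dist_real_def)
    also have "\<dots> \<le> ?L * ?S"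
      using le_S[OF x] lipschitz_on_nonneg[OF lip] by (intro mult_left_mono)
    finally show ?thesis .
  qed
  ultimately show ?thesis unfolding heat_rhs_def distrib_right by linarith
qed

lemma cauchy_solution_continuous:
  assumes "cauchy_solution G \<mu> \<omega> p a u\<^sub>0 T u" "x \<in> pverts G"
  shows "continuous_on {0..T} (u x)"
  using assms unfolding cauchy_solution_def C1_within_def
  by (meson DERIV_continuous_on)

lemma cauchy_solution_deriv:
  assumes "cauchy_solution G \<mu> \<omega> p a u\<^sub>0 T u" "x \<in> pverts G" "0 < t" "t < T"
  shows "(u x has_real_derivative heat_rhs (\<lambda>y. u y t) x) (at t)"
proof -
  have "(u x has_real_derivative heat_rhs (\<lambda>y. u y t) x) (at t within {0..T})"
    using assms unfolding cauchy_solution_def heat_rhs_def by auto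
  then show ?thesis using assms by (simp add: at_within_Icc_at)
qed

text \<open>
  The power term is only locally Lipschitz, but two given solutions on a compact time interval
  stay in some \<open>[-R, R]\<close>, and the comparison may depend on that \<open>R\<close>. This is why
  uniqueness holds on the full interval of existence, among all solutions.
\<close>

lemma cauchy_solution_mono:
  assumes u: "cauchy_solution G \<mu> \<omega> p a u\<^sub>0 T u" and v: "cauchy_solution G \<mu> \<omega> p a v\<^sub>0 T v"
    and init: "\<And>x. x \<in> pverts G \<Longrightarrow> u\<^sub>0 x \<le> v\<^sub>0 x"
    and x: "x \<in> pverts G" and t: "t \<in> {0..T}"
  shows "u x t \<le> v x t"
proof -
  have "bounded (\<Union>x\<in>pverts G. u x ` {0..T} \<union> v x ` {0..T})"
    using pair_finite_verts cauchy_solution_continuous[OF u] cauchy_solution_continuous[OF v]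
    by (intro bounded_UN ballI)
      (auto simp: bounded_Un intro!: compact_imp_bounded compact_continuous_image)
  then obtain R where R: "\<forall>z\<in>(\<Union>x\<in>pverts G. u x ` {0..T} \<union> v x ` {0..T}). \<bar>z\<bar> \<le> R"
    unfolding bounded_real by blast
  have R: "u x t \<in> {-R..R}" "v x t \<in> {-R..R}" if "x \<in> pverts G" "t \<in> {0..T}" for x t
  proof -
    have "\<bar>u x t\<bar> \<le> R" "\<bar>v x t\<bar> \<le> R" using R that by blast+
    then show "u x t \<in> {-R..R}" "v x t \<in> {-R..R}" by auto
  qed
  let ?L = "p * R powr (p - 1)" and ?W = "sum weighted_degree (pverts G)"
  have L: "?L \<ge> 0" using p_gt_1 by simp
  have "u x t - v x t \<le> 0"
  proof (rule cooperative_system_nonpos[OF pair_finite_verts,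
      where C = "?W + ?L" and T = T and d = "\<lambda>x t. u x t - v x t"
        and d' = "\<lambda>x t. heat_rhs (\<lambda>y. u y t) x - heat_rhs (\<lambda>y. v y t) x"])
    show "?W + ?L \<ge> 0" using L weighted_degree_nonneg by (simp add: sum_nonneg)
    show "continuous_on {0..T} (\<lambda>t. u x t - v x t)" if "x \<in> pverts G" for x
      by (intro continuous_intros cauchy_solution_continuous[OF u] cauchy_solution_continuous[OF v] that)
    show "((\<lambda>t. u x t - v x t) has_real_derivative
        heat_rhs (\<lambda>y. u y t) x - heat_rhs (\<lambda>y. v y t) x) (at t)"
      if "x \<in> pverts G" "0 < t" "t < T" for x t
      by (intro DERIV_diff cauchy_solution_deriv[OF u] cauchy_solution_deriv[OF v] that)
    show "u x 0 - v x 0 \<le> 0" if "x \<in> pverts G" for x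
      using init[OF that] u v that unfolding cauchy_solution_def by simp
    show "heat_rhs (\<lambda>y. u y t) x - heat_rhs (\<lambda>y. v y t) x
        \<le> (?W + ?L) * (\<Sum>y\<in>pverts G. max 0 (u y t - v y t))"
      if "x \<in> pverts G" "0 < t" "t < T" "0 < u x t - v x t" for x t
    proof -
      have "heat_rhs (\<lambda>y. u y t) x - heat_rhs (\<lambda>y. v y t) x
          \<le> (weighted_degree x + ?L) * (\<Sum>y\<in>pverts G. max 0 (u y t - v y t))"
        using that by (intro heat_rhs_diff_le R) auto
      also have "\<dots> \<le> (?W + ?L) * (\<Sum>y\<in>pverts G. max 0 (u y t - v y t))"
        using that weighted_degree_nonneg pair_finite_verts
        by (intro mult_right_mono add_right_mono member_le_sum sum_nonneg) auto
      finally show ?thesis .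
    qed
  qed (use x t in auto)
  then show ?thesis by simp
qed

lemma cauchy_solution_zero: "cauchy_solution G \<mu> \<omega> p a (\<lambda>_. 0) T (\<lambda>_ _. 0)"
  unfolding cauchy_solution_def C1_within_def graph_laplacian_def
  by (auto intro!: exI[of _ "\<lambda>_. 0"])

text \<open>
  The right-hand side is set to zero off the vertex set, so that it maps into bounded functions;
  these spurious coordinates never influence the vertices. Evaluation at a vertex is a bounded
  linear functional, which turns the vector-valued derivative into derivatives of each component.
\<close>

lemma cauchy_solution_exists:
  obtains T u where "T > 0" "cauchy_solution G \<mu> \<omega> p a u\<^sub>0 T u"
proof -
  define ext :: "('a \<Rightarrow> real) \<Rightarrow> 'a discrete \<Rightarrow>\<^sub>C real" where
    "ext f = Bcontfun (\<lambda>z. if of_discrete z \<in> pverts G then f (of_discrete z) else 0)" for f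
  have ext: "apply_bcontfun (ext f) z = (if of_discrete z \<in> pverts G then f (of_discrete z) else 0)"
    for f z
  proof -
    let ?h = "\<lambda>z. if of_discrete z \<in> pverts G then f (of_discrete z) else 0"
    have "range ?h \<subseteq> insert 0 (f ` pverts G)" by auto
    then have "bounded (range ?h)"
      using pair_finite_verts by (meson bounded_subset finite.insertI finite_imageI finite_imp_bounded)
    moreover have "continuous_on UNIV ?h"
      by (simp add: continuous_on_open_vimage open_discrete)
    ultimately show ?thesis unfolding ext_def by (simp add: Bcontfun_inverse bcontfun_def)
  qed
  define F where "F \<phi> = ext (heat_rhs (\<lambda>y. apply_bcontfun \<phi> (discrete y)))" for \<phi>
  (* The ball of radius 1 around the initial state lies in the box of half-width R. *)
  define R where "R = norm (ext u\<^sub>0) + 1"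
  have range_R: "apply_bcontfun \<phi> z \<in> {-R..R}" if "\<phi> \<in> cball (ext u\<^sub>0) 1" for \<phi> z
  proof -
    have "norm \<phi> \<le> R"
      using that norm_triangle_sub[of \<phi> "ext u\<^sub>0"] by (simp add: R_def dist_norm norm_minus_commute)
    then show ?thesis using norm_bounded[of \<phi> z] by (auto simp: abs_le_iff)
  qed
  obtain M where M: "M \<ge> 0"
    and M_lip: "\<And>f g D x. \<lbrakk>\<And>y. y \<in> pverts G \<Longrightarrow> f y \<in> {-R..R} \<and> g y \<in> {-R..R} \<and> \<bar>f y - g y\<bar> \<le> D;
       x \<in> pverts G\<rbrakk> \<Longrightarrow> \<bar>heat_rhs f x - heat_rhs g x\<bar> \<le> M * D"
    using heat_rhs_lipschitz by blast
  have F_lip: "M-lipschitz_on (cball (ext u\<^sub>0) 1) F"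
  proof (rule lipschitz_onI)
    fix \<phi> \<psi> assume mem: "\<phi> \<in> cball (ext u\<^sub>0) 1" "\<psi> \<in> cball (ext u\<^sub>0) 1"
    show "dist (F \<phi>) (F \<psi>) \<le> M * dist \<phi> \<psi>"
    proof (rule dist_bound)
      fix z
      show "dist (F \<phi> z) (F \<psi> z) \<le> M * dist \<phi> \<psi>"
        using M M_lip[of "\<lambda>y. \<phi> (discrete y)" "\<lambda>y. \<psi> (discrete y)" "dist \<phi> \<psi>" "of_discrete z"]
          range_R[OF mem(1)] range_R[OF mem(2)] dist_bounded[of \<phi> _ \<psi>]
        by (simp add: F_def ext dist_real_def)
    qed
  qed (rule M)
  obtain T w where T: "T > 0" and w0: "w 0 = ext u\<^sub>0"
    and w_ball: "\<And>t. t \<in> {0..T} \<Longrightarrow> w t \<in> cball (ext u\<^sub>0) 1"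
    and w_deriv: "\<And>t. t \<in> {0..T} \<Longrightarrow> (w has_vector_derivative F (w t)) (at t within {0..T})"
    using picard_lindelof[OF F_lip] by auto
  define u where "u x t = apply_bcontfun (w t) (discrete x)" for x t
  have eval: "bounded_linear (\<lambda>\<phi> :: 'a discrete \<Rightarrow>\<^sub>C real. apply_bcontfun \<phi> z)" for z
    by (rule bounded_linear_intro[where K = 1], simp, simp) (metis norm_bounded mult_1_right)
  have F_eval: "apply_bcontfun (F (w t)) (discrete x) = heat_rhs (\<lambda>y. u y t) x"
    if "x \<in> pverts G" for x t
    using that by (simp add: F_def ext u_def discrete_inverse)
  have u_deriv: "(u x has_real_derivative heat_rhs (\<lambda>y. u y t) x) (at t within {0..T})"
    if "x \<in> pverts G" "t \<in> {0..T}" for x t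
    using bounded_linear.has_vector_derivative[OF eval w_deriv[OF that(2)], of "discrete x"]
    by (simp add: F_eval[OF that(1)] u_def[abs_def] has_real_derivative_iff_has_vector_derivative)
  have "continuous_on {0..T} w"
    using w_deriv by (rule continuous_on_vector_derivative)
  then have "continuous_on {0..T} (\<lambda>t. F (w t))"
    using w_ball by (intro continuous_on_compose2[OF lipschitz_on_continuous_on[OF F_lip]]) auto
  then have F_cont: "continuous_on {0..T} (\<lambda>t. apply_bcontfun (F (w t)) (discrete x))" for x
    by (rule bounded_linear.continuous_on[OF eval])
  have rhs_cont: "continuous_on {0..T} (\<lambda>t. heat_rhs (\<lambda>y. u y t) x)" if "x \<in> pverts G" for x
    using F_cont[of x] unfolding F_eval[OF that] .
  have u_init: "u x 0 = u\<^sub>0 x" if "x \<in> pverts G" for x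
    using that by (simp add: u_def w0 ext discrete_inverse)
  have "cauchy_solution G \<mu> \<omega> p a u\<^sub>0 T u"
    unfolding cauchy_solution_def C1_within_def
  proof (intro ballI conjI exI)
    fix x assume x: "x \<in> pverts G"
    show "continuous_on {0..T} (\<lambda>t. heat_rhs (\<lambda>y. u y t) x)" by (rule rhs_cont[OF x])
    show "(u x has_real_derivative heat_rhs (\<lambda>y. u y t) x) (at t within {0..T})"
      if "t \<in> {0..T}" for t by (rule u_deriv[OF x that])
    show "(u x has_real_derivative graph_laplacian G \<mu> \<omega> (\<lambda>y. u y t) x - a x * u x t
        + \<bar>u x t\<bar> powr (p - 1) * u x t) (at t within {0..T})" if "t \<in> {0<..T}" for t
      using u_deriv[OF x, of t] that by (simp add: heat_rhs_def)
    show "u x 0 = u\<^sub>0 x" by (rule u_init[OF x])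
  qed
  with T show thesis by (rule that)
qed

end

theorem theorem2p1:
  fixes G :: "'a pair_pre_digraph"
    and \<mu> :: "'a \<Rightarrow> real" and \<omega> :: "'a \<Rightarrow> 'a \<Rightarrow> real"
    and p :: real and a u\<^sub>0 :: "'a \<Rightarrow> real"
  assumes "pair_pseudo_graph G" and "Digraph_Component.connected (with_proj G)"
    and "\<And>x. x \<in> pverts G \<Longrightarrow> \<mu> x > 0"
    and "\<And>x y. (x, y) \<in> parcs G \<Longrightarrow> \<omega> x y > 0"
    and "\<And>x y. (x, y) \<in> parcs G \<Longrightarrow> \<omega> x y = \<omega> y x"
    and "p > 1"
    and "\<And>x. x \<in> pverts G \<Longrightarrow> a x \<ge> 0"
    and "\<exists>x\<in>pverts G. a x \<noteq> 0"
  shows "\<exists>T>0. \<exists>u. cauchy_solution G \<mu> \<omega> p a u\<^sub>0 T u \<and>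
           (\<forall>v. cauchy_solution G \<mu> \<omega> p a u\<^sub>0 T v \<longrightarrow>
              (\<forall>x\<in>pverts G. \<forall>t\<in>{0..T}. v x t = u x t)) \<and>
           ((\<forall>x\<in>pverts G. u\<^sub>0 x \<ge> 0) \<longrightarrow> (\<forall>x\<in>pverts G. \<forall>t\<in>{0..T}. u x t \<ge> 0))"
proof -
  interpret pair_pseudo_graph G by fact
  interpret semilinear_heat G \<mu> \<omega> p a
    by unfold_locales (use assms in auto)
  obtain T u where T: "T > 0" and u: "cauchy_solution G \<mu> \<omega> p a u\<^sub>0 T u"
    by (rule cauchy_solution_exists)
  have "v x t = u x t"
    if "cauchy_solution G \<mu> \<omega> p a u\<^sub>0 T v" "x \<in> pverts G" "t \<in> {0..T}" for v x t
    using cauchy_solution_mono[OF u that(1) _ that(2,3)] cauchy_solution_mono[OF that(1) u _ that(2,3)]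
    by (simp add: order_antisym)
  moreover have "u x t \<ge> 0"
    if "\<forall>x\<in>pverts G. u\<^sub>0 x \<ge> 0" "x \<in> pverts G" "t \<in> {0..T}" for x t
    using cauchy_solution_mono[OF cauchy_solution_zero u _ that(2,3)] that(1) by simp
  ultimately show ?thesis using T u by blast
qed

end
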